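(* Let $\mathbb{F}$ be a field, let $d\in\mathbb{N}=\{0,1,2,\dots\}$, and let $V$ be a $(d+1)$-dimensional $\mathbb{F}$-vector space. Let $A:V\to V$ be a multiplicity-free $\mathbb{F}$-linear map, with a fixed ordering $\theta_0,\dots,\theta_d$ of its eigenvalues. For $0\le i\le d$ let $E_i$ be the primitive idempotent of $A$ corresponding to $\theta_i$ and pick a nonzero vector $\mathbf{v}_i\in E_iV$; let $\mathbf{v}=\mathbf{v}_0+\cdots+\mathbf{v}_d$. For $(r,s,t)\in\Delta_d$ define $\mathcal{L}_{(r,s,t)}=\eta_r(A)\tau_t(A)\mathbf{v}$. For $0\le i\le d$ consider the location $\lambda_i=(d-i,0,i)\in\Delta_d$. Then $\mathcal{L}_{\lambda_i}\in E_iV$.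
   Context: $A$ is multiplicity-free if it is diagonalizable and every eigenspace has dimension 1. The primitive idempotent $E_i$ is the linear map $V\to V$ acting as the identity on the $\theta_i$-eigenspace of $A$ and as $0$ on the other eigenspaces; so $E_iV$ is the $\theta_i$-eigenspace. For $0\le k\le d$, $\tau_k(\xi)=\prod_{i=1}^{k}(\xi-\theta_{i-1})$ and $\eta_k(\xi)=\prod_{i=1}^{k}(\xi-\theta_{d-i+1})$, with $\tau_0=\eta_0=1$. $\Delta_d=\{(r,s,t)\mid r,s,t\in\mathbb{N},\ r+s+t=d\}$; its elements are called locations. *)

theory Defs
  imports Complex_Main "HOL-Computational_Algebra.Polynomial"
begin

definition eigenspace ::
    "('a::field \<Rightarrow> 'b::ab_group_add \<Rightarrow> 'b) \<Rightarrow> ('b \<Rightarrow> 'b) \<Rightarrow> 'a \<Rightarrow> 'b set" where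
  "eigenspace scale A \<mu> = {x. A x = scale \<mu> x}"

definition eigenvalues ::
    "('a::field \<Rightarrow> 'b::ab_group_add \<Rightarrow> 'b) \<Rightarrow> ('b \<Rightarrow> 'b) \<Rightarrow> 'a set" where
  "eigenvalues scale A = {\<mu>. \<exists>x. x \<noteq> 0 \<and> A x = scale \<mu> x}"

definition diagonalizable ::
    "('a::field \<Rightarrow> 'b::ab_group_add \<Rightarrow> 'b) \<Rightarrow> ('b \<Rightarrow> 'b) \<Rightarrow> bool" where
  "diagonalizable scale A \<longleftrightarrow>
     (\<exists>B. \<not> module.dependent scale B \<and> module.span scale B = UNIV \<and>
          (\<forall>b\<in>B. \<exists>\<mu>. b \<in> eigenspace scale A \<mu>))"

definition multiplicity_free ::
    "('a::field \<Rightarrow> 'b::ab_group_add \<Rightarrow> 'b) \<Rightarrow> ('b \<Rightarrow> 'b) \<Rightarrow> bool" where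
  "multiplicity_free scale A \<longleftrightarrow>
     diagonalizable scale A \<and>
     (\<forall>\<mu>\<in>eigenvalues scale A. vector_space.dim scale (eigenspace scale A \<mu>) = 1)"

(* For diagonalizable A the space is the direct sum of the eigenspaces, so exactly
   one map E satisfies this predicate for a given eigenvalue \<mu>. *)
definition is_primitive_idempotent ::
    "('a::field \<Rightarrow> 'b::ab_group_add \<Rightarrow> 'b) \<Rightarrow> ('b \<Rightarrow> 'b) \<Rightarrow> 'a \<Rightarrow> ('b \<Rightarrow> 'b) \<Rightarrow> bool" where
  "is_primitive_idempotent scale A \<mu> E \<longleftrightarrow>
     Vector_Spaces.linear scale scale E \<and>
     (\<forall>x\<in>eigenspace scale A \<mu>. E x = x) \<and>
     (\<forall>\<nu>\<in>eigenvalues scale A - {\<mu>}. \<forall>x\<in>eigenspace scale A \<nu>. E x = 0)"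

definition poly_map ::
    "('a::field \<Rightarrow> 'b::ab_group_add \<Rightarrow> 'b) \<Rightarrow> 'a poly \<Rightarrow> ('b \<Rightarrow> 'b) \<Rightarrow> 'b \<Rightarrow> 'b" where
  "poly_map scale p A x = (\<Sum>n\<le>degree p. scale (coeff p n) ((A ^^ n) x))"

definition tau :: "(nat \<Rightarrow> 'a::field) \<Rightarrow> nat \<Rightarrow> 'a poly" where
  "tau \<theta> k = (\<Prod>i=1..k. [:- \<theta> (i - 1), 1:])"

(* Only meaningful for k \<le> d, where the subtraction d - i does not truncate. *)
definition eta :: "nat \<Rightarrow> (nat \<Rightarrow> 'a::field) \<Rightarrow> nat \<Rightarrow> 'a poly" where
  "eta d \<theta> k = (\<Prod>i=1..k. [:- \<theta> (d - i + 1), 1:])"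

definition locations :: "nat \<Rightarrow> (nat \<times> nat \<times> nat) set" where
  "locations d = {(r, s, t). r + s + t = d}"

end

theory Submission
  imports Defs
begin

text \<open>Each \<open>vs j\<close> is an eigenvector for \<open>\<theta> j\<close>, so \<open>\<eta>\<^sub>r(A) \<tau>\<^sub>t(A)\<close> multiplies it by
  \<open>\<eta>\<^sub>r(\<theta> j) \<tau>\<^sub>t(\<theta> j)\<close>. For \<open>r = d - i\<close> and \<open>t = i\<close> the roots of \<open>\<tau>\<^sub>t\<close> are the \<open>\<theta> j\<close> with \<open>j < i\<close>
  and those of \<open>\<eta>\<^sub>r\<close> are the \<open>\<theta> j\<close> with \<open>j > i\<close>, so only a multiple of \<open>vs i\<close> survives.\<close>

lemma poly_tau_eq_0:
  assumes "j < k"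
  shows "poly (tau \<theta> k) (\<theta> j) = 0"
proof -
  have "Suc j \<in> {1..k}" and "poly [:- \<theta> (Suc j - 1), 1:] (\<theta> j) = 0"
    using assms by auto
  then show ?thesis
    unfolding tau_def poly_prod by (meson finite_atLeastAtMost prod_zero)
qed

lemma poly_eta_eq_0:
  assumes "j \<le> d" "k \<le> d" "d < j + k"
  shows "poly (eta d \<theta> k) (\<theta> j) = 0"
proof -
  \<comment> \<open>The factor with root \<open>\<theta> j\<close> has index
    \<open>d - j + 1\<close>, and \<open>d < j + k\<close> puts it in range. Together with
    \<open>k \<le> d\<close> this also forces \<open>j > 0\<close>, so
    \<open>d - (d - j + 1)\<close> does not truncate.\<close>
  have "d - j + 1 \<in> {1..k}" and "poly [:- \<theta> (d - (d - j + 1) + 1), 1:] (\<theta> j) = 0"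
    using assms by auto
  then show ?thesis
    unfolding eta_def poly_prod by (meson finite_atLeastAtMost prod_zero)
qed

context vector_space
begin

lemma subspace_eigenspace:
  assumes "Vector_Spaces.linear scale scale A"
  shows "subspace (eigenspace scale A \<mu>)"
proof -
  interpret A: Vector_Spaces.linear scale scale A by fact
  show ?thesis
    by (auto simp: subspace_def eigenspace_def A.zero A.add A.scale scale_right_distrib
        mult.commute)
qed

text \<open>\<open>E\<close> is prescribed only on eigenspaces, but an eigenbasis determines it:
  every basis vector is either fixed or sent to 0.\<close>

lemma range_primitive_idempotent:
  assumes A: "Vector_Spaces.linear scale scale A"
    and diag: "diagonalizable scale A"
    and E: "is_primitive_idempotent scale A \<mu> E"
  shows "range E = eigenspace scale A \<mu>"
proof
  interpret E: Vector_Spaces.linear scale scale E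
    using E by (simp add: is_primitive_idempotent_def)
  show "eigenspace scale A \<mu> \<subseteq> range E"
    using E unfolding is_primitive_idempotent_def by (metis rangeI subsetI)
  obtain B where indep: "independent B" and span: "span B = UNIV"
    and B: "\<And>b. b \<in> B \<Longrightarrow> \<exists>\<nu>. b \<in> eigenspace scale A \<nu>"
    using diag unfolding diagonalizable_def by blast
  have sub: "subspace (eigenspace scale A \<mu>)"
    by (rule subspace_eigenspace [OF A])
  have "E b \<in> eigenspace scale A \<mu>" if b: "b \<in> B" for b
  proof -
    obtain \<nu> where \<nu>: "b \<in> eigenspace scale A \<nu>"
      using B b by blast
    \<comment> \<open>The defining property of \<open>E\<close> kills only eigenspaces of genuine
      eigenvalues, so \<open>\<nu>\<close> needs a nonzero eigenvector.\<close>
    have "b \<noteq> 0"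
      using b indep dependent_zero by blast
    then have "\<nu> \<in> eigenvalues scale A"
      using \<nu> by (auto simp: eigenvalues_def eigenspace_def)
    then have "E b = (if \<nu> = \<mu> then b else 0)"
      using E \<nu> by (auto simp: is_primitive_idempotent_def)
    then show ?thesis
      using \<nu> subspace_0 [OF sub] by auto
  qed
  then have "E ` span B \<subseteq> eigenspace scale A \<mu>"
    unfolding E.span_image [symmetric] by (intro span_minimal sub) auto
  then show "range E \<subseteq> eigenspace scale A \<mu>"
    by (simp add: span)
qed

lemma funpow_eigenvector:
  assumes "Vector_Spaces.linear scale scale A" "x \<in> eigenspace scale A \<mu>"
  shows "(A ^^ n) x = scale (\<mu> ^ n) x"
proof -
  interpret A: Vector_Spaces.linear scale scale A by fact
  show ?thesis
    using assms(2) by (induction n) (auto simp: A.scale eigenspace_def mult.commute)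
qed

lemma poly_map_eigenvector:
  assumes "Vector_Spaces.linear scale scale A" "x \<in> eigenspace scale A \<mu>"
  shows "poly_map scale p A x = scale (poly p \<mu>) x"
  by (simp add: poly_map_def funpow_eigenvector [OF assms] poly_altdef scale_sum_left)

text \<open>Powers of \<open>A\<close> are additive; this lets both polynomials act on
  \<open>v\<close> one eigenvector at a time.\<close>

lemma poly_map_sum:
  assumes "Vector_Spaces.linear scale scale A"
  shows "poly_map scale p A (\<Sum>j\<in>J. f j) = (\<Sum>j\<in>J. poly_map scale p A (f j))"
proof -
  interpret A: Vector_Spaces.linear scale scale A by fact
  have "(A ^^ n) (\<Sum>j\<in>J. f j) = (\<Sum>j\<in>J. (A ^^ n) (f j))" for n
    by (induction n) (simp_all add: A.sum)
  then show ?thesis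
    by (simp add: poly_map_def scale_sum_right sum.swap [of _ J])
qed

end

theorem lemma5p10:
  fixes scale :: "'a::field \<Rightarrow> 'b::ab_group_add \<Rightarrow> 'b"
    and d :: nat
    and A :: "'b \<Rightarrow> 'b"
    and \<theta> :: "nat \<Rightarrow> 'a"
    and E :: "nat \<Rightarrow> 'b \<Rightarrow> 'b"
    and vs :: "nat \<Rightarrow> 'b"
    and v :: 'b
    and L :: "nat \<times> nat \<times> nat \<Rightarrow> 'b"
    and i :: nat
  assumes "vector_space scale"
    and "vector_space.dim scale (UNIV :: 'b set) = d + 1"
    and "Vector_Spaces.linear scale scale A"
    and "multiplicity_free scale A"
    and "bij_betw \<theta> {0..d} (eigenvalues scale A)"
    and "\<forall>j\<le>d. is_primitive_idempotent scale A (\<theta> j) (E j)"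
    and "\<forall>j\<le>d. vs j \<in> range (E j) \<and> vs j \<noteq> 0"
    and "v = (\<Sum>j=0..d. vs j)"
    and "\<forall>r s t. (r, s, t) \<in> locations d \<longrightarrow>
           L (r, s, t) =
             poly_map scale (eta d \<theta> r) A
               (poly_map scale (tau \<theta> t) A v)"
    and "i \<le> d"
  shows "L (d - i, 0, i) \<in> range (E i)"
proof -
  interpret vector_space scale by fact
  note A = assms(3)
  have range: "range (E j) = eigenspace scale A (\<theta> j)" if "j \<le> d" for j
    using range_primitive_idempotent [OF A] assms(4,6) that
    by (auto simp: multiplicity_free_def)
  have vs: "vs j \<in> eigenspace scale A (\<theta> j)" if "j \<le> d" for j
    using assms(7) range that by blast
  \<comment> \<open>After \<open>tau\<close> has acted, \<open>eta\<close> meets a multiple of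
    \<open>vs j\<close>, which must again be known to be an eigenvector.\<close>
  have scaled: "scale c (vs j) \<in> eigenspace scale A (\<theta> j)" if "j \<le> d" for c j
    by (rule subspace_scale [OF subspace_eigenspace [OF A] vs [OF that]])
  define c where "c j = poly (eta d \<theta> (d - i)) (\<theta> j) * poly (tau \<theta> i) (\<theta> j)" for j
  have "(d - i, 0, i) \<in> locations d"
    using assms(10) by (simp add: locations_def)
  then have "L (d - i, 0, i) =
      poly_map scale (eta d \<theta> (d - i)) A (poly_map scale (tau \<theta> i) A v)"
    using assms(9) by blast
  also have "\<dots> = (\<Sum>j=0..d. scale (c j) (vs j))"
    unfolding assms(8) poly_map_sum [OF A]
    by (intro sum.cong refl)
      (simp add: poly_map_eigenvector [OF A vs] poly_map_eigenvector [OF A scaled] c_def)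
  also have "\<dots> = (\<Sum>j\<in>{i}. scale (c j) (vs j))"
  proof (intro sum.mono_neutral_right ballI)
    fix j assume "j \<in> {0..d} - {i}"
    \<comment> \<open>The second case is \<open>j > i\<close>, written in the form that
      \<open>poly_eta_eq_0\<close> expects for \<open>k = d - i\<close>.\<close>
    then have "j < i \<or> j \<le> d \<and> d < j + (d - i)"
      using assms(10) by auto
    then have "c j = 0"
      unfolding c_def by (auto simp: poly_tau_eq_0 poly_eta_eq_0)
    then show "scale (c j) (vs j) = 0"
      by simp
  qed (use assms(10) in auto)
  finally show ?thesis
    using scaled [OF assms(10)] range [OF assms(10)] by simp
qed

end
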